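(* Let $c>0$ and $\Delta=(0,c]$. Let $F,G$ be distributions on $\mathbb R$ and $H=G*F\in\mathcal S_\Delta$, where $G$ is a compound Poisson distribution. Suppose that $H\in\mathcal D_\Delta$ or that $F,G,H$ are distributions on $\mathbb R_+=[0,\infty)$. Then $G(x+\Delta)=o(H(x+\Delta))$ as $x\to\infty$ implies $F\in\mathcal S_\Delta$, and indeed $H(x+\Delta)\sim F(x+\Delta)$.
   Context: A compound Poisson distribution is a distribution of the form $e^{-\lambda}\sum_{n\ge0}(\lambda^n/n!)Q^{*n}$ with $\lambda>0$ and $Q$ a probability distribution on $\mathbb R$, where $Q^{*n}$ is the $n$-fold convolution and $Q^{*0}$ the Dirac measure at $0$. For $\Delta=(0,c]$ and a distribution $F$ on $\mathbb R$, $F(x+\Delta):=F((x,x+c])$. $F*G$ is the convolution. $\alpha(x)\sim\beta(x)$ means $\alpha(x)/\beta(x)\to1$ as $x\to\infty$. A non-negative measurable function $\alpha$ belongs to $\mathcal L$ if there is $x_0>0$ with $\alpha(x)>0$ for $x\ge x_0$ and, for every fixed $y>0$, $\alpha(x+y)\sim\alpha(x)$. $F\in\mathcal L_\Delta$ if $x\mapsto F(x+\Delta)$ is in $\mathcal L$; $F\in\mathcal S_\Delta$ if $F\in\mathcal L_\Delta$ and $F^{*2}(x+\Delta)\sim 2F(x+\Delta)$. A function $\alpha:\mathbb R\to\mathbb R_+$ is almost decreasing if there exist $x_0>0$ and $K>0$ such that $\alpha(x+y)\le K\alpha(x)$ for all $x>x_0$, $y>0$. $F\in\mathcal D_\Delta$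 if $x\mapsto F(x+\Delta)$ is almost decreasing. *)

theory Defs
  imports "HOL-Probability.Probability" "HOL-Library.Landau_Symbols"
begin

primrec conv_power :: "real measure \<Rightarrow> nat \<Rightarrow> real measure" where
  "conv_power Q 0 = return borel 0"
| "conv_power Q (Suc n) = convolution Q (conv_power Q n)"

definition compound_poisson :: "real measure \<Rightarrow> bool" where
  "compound_poisson G \<longleftrightarrow> real_distribution G \<and>
     (\<exists>rate>0. \<exists>Q. real_distribution Q \<and>
        (\<forall>A \<in> sets borel.
           (\<lambda>n. exp (- rate) * (rate ^ n / fact n) * measure (conv_power Q n) A) sums measure G A))"

text \<open>For \<open>\<Delta> = (0, c]\<close>, the function \<open>mass_Delta c F\<close> is \<open>x \<mapsto> F (x + \<Delta>)\<close>.\<close>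

definition mass_Delta :: "real \<Rightarrow> real measure \<Rightarrow> real \<Rightarrow> real" where
  "mass_Delta c F x = measure F {x<..x + c}"

text \<open>
  The relation \<open>asymp_equiv\<close> treats the quotient \<open>0 / 0\<close> as \<open>1\<close>. In all uses below one
  of the two functions is positive near infinity, so that it just says that the quotient
  tends to \<open>1\<close>.
\<close>

definition class_L :: "(real \<Rightarrow> real) set" where
  "class_L = {\<alpha> \<in> borel_measurable borel. (\<forall>x. \<alpha> x \<ge> 0) \<and>
     (\<exists>x0>0. \<forall>x\<ge>x0. \<alpha> x > 0) \<and>
     (\<forall>y>0. (\<lambda>x. \<alpha> (x + y)) \<sim>[at_top] \<alpha>)}"

definition L_Delta :: "real \<Rightarrow> real measure set" where
  "L_Delta c = {F. real_distribution F \<and> mass_Delta c F \<in> class_L}"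

definition S_Delta :: "real \<Rightarrow> real measure set" where
  "S_Delta c = {F \<in> L_Delta c.
     mass_Delta c (convolution F F) \<sim>[at_top] (\<lambda>x. 2 * mass_Delta c F x)}"

definition almost_decreasing :: "(real \<Rightarrow> real) \<Rightarrow> bool" where
  "almost_decreasing \<alpha> \<longleftrightarrow> (\<exists>x0>0. \<exists>K>0. \<forall>x>x0. \<forall>y>0. \<alpha> (x + y) \<le> K * \<alpha> x)"

definition D_Delta :: "real \<Rightarrow> real measure set" where
  "D_Delta c = {F. real_distribution F \<and> almost_decreasing (mass_Delta c F)}"

definition on_nonneg :: "real measure \<Rightarrow> bool" where
  "on_nonneg F \<longleftrightarrow> measure F {0..} = 1"

end

theory Submission
  imports Defs
begin

text \<open>
  Write \<open>h x = H (x + \<Delta>)\<close> and let \<open>G\<close> be compound Poisson with rate \<open>r\<close> and jump law \<open>Q\<close>.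
  As an element of the convolution algebra, \<open>G = exp (r (Q - \<delta>\<^sub>0))\<close> is invertible, its inverse being
  the signed measure \<open>exp r * (\<Sum>n. (- r) ^ n / fact n * Q^n)\<close>. So the convolution with \<open>G\<close> can be
  undone: \<open>M = G * F'\<close> implies
  \<open>F' = exp r * (\<Sum>n. (- r) ^ n / fact n * (Q^n * M))\<close>. The absolute value of the inverse is
  at most \<open>exp (2 r)\<close> times \<open>G\<close>, and therefore it inherits from \<open>G\<close> that its local masses
  are \<open>o(h)\<close>.

  A distribution whose local masses are \<open>o(h)\<close> acts on local masses asymptotically like \<open>\<delta>\<^sub>0\<close>
  (\<open>convolution_locally_small_tendsto\<close>): if \<open>M (x + \<Delta>) / h x\<close> tends to \<open>m\<close>, so does
  \<open>(P * M) (x + \<Delta>) / h x\<close>. This applies to \<open>P = G\<close> and to each \<open>P = Q^n\<close>, which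
  is dominated by a multiple of \<open>G\<close>. The first instance says that the positive series
  \<open>\<Sum>n. exp (- r) * r ^ n / fact n * (Q^n * M) (x + \<Delta>) / h x\<close> converges to the sum of the limits of its
  terms, so that its tails are uniformly small, and one may pass to the limit in the
  alternating series as well. The signed weights add up to \<open>exp r * exp (- r) = 1\<close>. Hence
  \<open>F' (x + \<Delta>) / h x\<close> has the same limit as \<open>(G * F') (x + \<Delta>) / h x\<close>
  (\<open>compound_poisson_deconvolution_tendsto\<close>).

  This is used for three distributions \<open>F'\<close> in turn. From \<open>G * F = H\<close> follows that \<open>F (x + \<Delta>) / h x\<close>
  tends to 1, from \<open>G * (F * H) = H * H\<close> that \<open>(F * H) (x + \<Delta>) / h x\<close> tends to 2, and from
  \<open>G * (F * F) = F * H\<close> that \<open>(F * F) (x + \<Delta>) / h x\<close> tends to 2. Since \<open>F\<close> and \<open>H\<close> have equivalent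
  local masses, this is local subexponentiality of \<open>F\<close>.
\<close>

section \<open>Convolution of distributions on the line\<close>

lemma real_distribution_convolution:
  assumes "real_distribution M" "real_distribution N"
  shows "real_distribution (convolution M N)"
proof -
  interpret M: real_distribution M by fact
  interpret N: real_distribution N by fact
  interpret MN: pair_prob_space M N ..
  show ?thesis
    unfolding convolution_def
    by (intro real_distribution.intro real_distribution_axioms.intro MN.prob_space_distr) auto
qed

lemma real_distribution_conv_power:
  assumes "real_distribution Q"
  shows "real_distribution (conv_power Q n)"
proof (induction n)
  case 0
  show ?case
    by (auto intro!: real_distribution.intro real_distribution_axioms.intro prob_space_return)
next
  case (Suc n)
  then show ?case
    using assms by (simp add: real_distribution_convolution)
qed

lemma real_distribution_convolution_commute:
  assumes "real_distribution M" "real_distribution N"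
  shows "convolution M N = convolution N M"
proof -
  interpret M: real_distribution M by fact
  interpret N: real_distribution N by fact
  show ?thesis
    by (rule convolution_commutative) (auto intro: M.finite_measure_axioms N.finite_measure_axioms)
qed

lemma real_distribution_convolution_assoc:
  assumes "real_distribution L" "real_distribution M" "real_distribution N"
  shows "convolution L (convolution M N) = convolution (convolution L M) N"
proof -
  interpret L: real_distribution L by fact
  interpret M: real_distribution M by fact
  interpret N: real_distribution N by fact
  show ?thesis
    by (rule convolution_associative)
       (auto intro: L.finite_measure_axioms M.finite_measure_axioms N.finite_measure_axioms)
qed

lemma convolution_return_zero:
  assumes "real_distribution M"
  shows "convolution (return borel 0) M = M"
proof -
  interpret M: real_distribution M by fact
  interpret R: prob_space "return borel (0::real)"
    by (simp add: prob_space_return)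
  show ?thesis
  proof (rule measure_eqI)
    fix A assume "A \<in> sets (convolution (return borel 0) M)"
    then have A [measurable]: "A \<in> sets borel" by simp
    have "emeasure (convolution (return borel 0) M) A
        = (\<integral>\<^sup>+x. \<integral>\<^sup>+y. indicator A (x + y) \<partial>M \<partial>return borel 0)"
      by (rule convolution_emeasure')
         (auto intro: R.finite_measure_axioms M.finite_measure_axioms)
    also have "\<dots> = (\<integral>\<^sup>+y. indicator A y \<partial>M)"
      by (subst nn_integral_return) auto
    also have "\<dots> = emeasure M A" by simp
    finally show "emeasure (convolution (return borel 0) M) A = emeasure M A" .
  qed simp
qed

lemma measure_convolution:
  assumes "real_distribution M" "real_distribution N" and A [measurable]: "A \<in> sets borel"
  shows "measure (convolution M N) A = (\<integral>y. measure M {x. x + y \<in> A} \<partial>N)"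
    and "integrable N (\<lambda>y. measure M {x. x + y \<in> A})"
proof -
  interpret M: real_distribution M by fact
  interpret N: real_distribution N by fact
  have [measurable]: "(\<lambda>y. measure M {x. x + y \<in> A}) \<in> borel_measurable N"
  proof -
    have "(\<lambda>p. snd p + fst p) -` A \<inter> space (borel \<Otimes>\<^sub>M M) \<in> sets (borel \<Otimes>\<^sub>M M)"
      by measurable
    then have "{(y, x). x + y \<in> A} \<in> sets (borel \<Otimes>\<^sub>M M)"
      by (simp add: vimage_def case_prod_unfold space_pair_measure)
    then have "(\<lambda>y. emeasure M (Pair y -` {(y, x). x + y \<in> A})) \<in> borel_measurable borel"
      by (rule M.measurable_emeasure_Pair)
    then have "(\<lambda>y. enn2real (emeasure M {x. x + y \<in> A})) \<in> borel_measurable borel"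
      by (simp add: vimage_def)
    then show ?thesis
      by (simp add: measure_def)
  qed
  show int: "integrable N (\<lambda>y. measure M {x. x + y \<in> A})"
    by (rule N.integrable_const_bound[where B = 1]) auto
  have "emeasure (convolution M N) A = emeasure (convolution N M) A"
    using real_distribution_convolution_commute[OF assms(1,2)] by simp
  also have "\<dots> = (\<integral>\<^sup>+y. emeasure M {x. x + y \<in> A} \<partial>N)"
    by (rule convolution_emeasure)
       (auto intro: M.finite_measure_axioms N.finite_measure_axioms)
  also have "\<dots> = (\<integral>\<^sup>+y. ennreal (measure M {x. x + y \<in> A}) \<partial>N)"
    by (simp add: M.emeasure_eq_measure)
  also have "\<dots> = ennreal (\<integral>y. measure M {x. x + y \<in> A} \<partial>N)"
    by (rule nn_integral_eq_integral[OF int]) simp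
  finally show "measure (convolution M N) A = (\<integral>y. measure M {x. x + y \<in> A} \<partial>N)"
    by (simp add: measure_def integral_nonneg_AE)
qed

lemma on_nonneg_iff_AE:
  assumes "real_distribution M"
  shows "on_nonneg M \<longleftrightarrow> (AE x in M. 0 \<le> x)"
proof -
  interpret M: real_distribution M by fact
  show ?thesis
    unfolding on_nonneg_def using M.prob_eq_1[of "{0..}"] by simp
qed

lemma on_nonneg_convolution:
  assumes "real_distribution M" "real_distribution N" "on_nonneg M" "on_nonneg N"
  shows "on_nonneg (convolution M N)"
proof -
  interpret M: real_distribution M by fact
  interpret N: real_distribution N by fact
  interpret MN: pair_prob_space M N ..
  have "AE x in M. 0 \<le> x" "AE x in N. 0 \<le> x"
    using assms by (auto simp: on_nonneg_iff_AE)
  then have "AE x in M. AE y in N. 0 \<le> x + y"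
    by (auto elim!: eventually_mono)
  moreover have "{p \<in> space (M \<Otimes>\<^sub>M N). 0 \<le> fst p + snd p} \<in> sets (M \<Otimes>\<^sub>M N)"
    by measurable
  ultimately have "AE p in M \<Otimes>\<^sub>M N. 0 \<le> fst p + snd p"
    by (intro MN.AE_pair_measure) auto
  then have "AE x in convolution M N. 0 \<le> x"
    unfolding convolution_def by (subst AE_distr_iff) (auto simp: case_prod_beta)
  then show ?thesis
    using on_nonneg_iff_AE real_distribution_convolution assms by blast
qed

section \<open>Local masses of convolutions, split by one summand\<close>

lemma mass_Delta_nonneg [simp]: "0 \<le> mass_Delta c M x"
  by (simp add: mass_Delta_def)

lemma borel_measurable_mass_Delta [measurable]:
  assumes "c > 0" "real_distribution M"
  shows "mass_Delta c M \<in> borel_measurable borel"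
proof -
  interpret M: real_distribution M by fact
  have cdf [measurable]: "cdf M \<in> borel_measurable borel"
    by (rule borel_measurable_mono) (auto simp: mono_def intro: M.cdf_nondecreasing)
  have "mass_Delta c M = (\<lambda>x. cdf M (x + c) - cdf M x)"
    using \<open>c > 0\<close> by (auto simp: mass_Delta_def M.cdf_diff_eq)
  then show ?thesis by simp
qed

lemma sets_sum_strip:
  fixes x c :: real
  assumes [measurable]: "B \<in> sets borel"
    and [measurable_cong]: "sets P = sets borel" "sets M = sets borel"
  shows "{(u, v). u \<in> B \<and> x < u + v \<and> u + v \<le> x + c} \<in> sets (P \<Otimes>\<^sub>M M)"
    and "{(u, v). v \<in> B \<and> x < u + v \<and> u + v \<le> x + c} \<in> sets (P \<Otimes>\<^sub>M M)"
proof -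
  have sp: "space (P \<Otimes>\<^sub>M M) = UNIV"
    using sets_eq_imp_space_eq[OF assms(2)] sets_eq_imp_space_eq[OF assms(3)]
    by (simp add: space_pair_measure)
  have "{p \<in> space (P \<Otimes>\<^sub>M M). fst p \<in> B \<and> x < fst p + snd p \<and> fst p + snd p \<le> x + c}
      \<in> sets (P \<Otimes>\<^sub>M M)"
    by measurable
  then show "{(u, v). u \<in> B \<and> x < u + v \<and> u + v \<le> x + c} \<in> sets (P \<Otimes>\<^sub>M M)"
    by (simp add: sp case_prod_unfold)
  have "{p \<in> space (P \<Otimes>\<^sub>M M). snd p \<in> B \<and> x < fst p + snd p \<and> fst p + snd p \<le> x + c}
      \<in> sets (P \<Otimes>\<^sub>M M)"
    by measurable
  then show "{(u, v). v \<in> B \<and> x < u + v \<and> u + v \<le> x + c} \<in> sets (P \<Otimes>\<^sub>M M)"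
    by (simp add: sp case_prod_unfold)
qed

text \<open>
  For independent \<open>U\<close> and \<open>V\<close> with laws \<open>P\<close> and \<open>M\<close>, this is the probability that
  \<open>U \<in> B\<close> and \<open>U + V \<in> x + \<Delta>\<close>. The integral is the definition because estimates of
  the integrand are what it is used for; the symmetric description is \<open>conv_mass_eq_measure\<close>.
\<close>

definition conv_mass :: "real \<Rightarrow> real measure \<Rightarrow> real measure \<Rightarrow> real set \<Rightarrow> real \<Rightarrow> real" where
  "conv_mass c P M B x = (\<integral>u. indicator B u * mass_Delta c M (x - u) \<partial>P)"

lemma conv_mass_integrable:
  assumes "c > 0" "real_distribution P" "real_distribution M" and B [measurable]: "B \<in> sets borel"
  shows "integrable P (\<lambda>u. indicator B u * mass_Delta c M (x - u))"
proof -
  interpret P: real_distribution P by fact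
  interpret M: real_distribution M by fact
  note [measurable] = borel_measurable_mass_Delta[OF assms(1,3)]
  show ?thesis
  proof (rule P.integrable_const_bound[where B = 1])
    show "AE u in P. norm (indicator B u * mass_Delta c M (x - u)) \<le> 1"
      by (auto simp: mass_Delta_def indicator_def)
  qed measurable
qed

lemma conv_mass_eq_measure:
  assumes "c > 0" "real_distribution P" "real_distribution M" and B [measurable]: "B \<in> sets borel"
  shows "conv_mass c P M B x = measure (P \<Otimes>\<^sub>M M) {(u, v). u \<in> B \<and> x < u + v \<and> u + v \<le> x + c}"
proof -
  interpret P: real_distribution P by fact
  interpret M: real_distribution M by fact
  interpret PM: pair_prob_space P M ..
  let ?S = "{(u, v). u \<in> B \<and> x < u + v \<and> u + v \<le> x + c}"
  have S: "?S \<in> sets (P \<Otimes>\<^sub>M M)" by (rule sets_sum_strip) auto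
  have slice: "emeasure M (Pair u -` ?S) = ennreal (indicator B u * mass_Delta c M (x - u))" for u
  proof -
    have "Pair u -` ?S = (if u \<in> B then {x - u<..x - u + c} else {})" by auto
    then show ?thesis by (simp add: M.emeasure_eq_measure mass_Delta_def)
  qed
  have "emeasure (P \<Otimes>\<^sub>M M) ?S = (\<integral>\<^sup>+u. emeasure M (Pair u -` ?S) \<partial>P)"
    by (rule M.emeasure_pair_measure_alt[OF S])
  also have "\<dots> = ennreal (conv_mass c P M B x)"
    unfolding slice conv_mass_def
    by (rule nn_integral_eq_integral[OF conv_mass_integrable[OF assms]]) simp
  finally show ?thesis
    by (simp add: measure_def conv_mass_def integral_nonneg_AE)
qed

lemma mass_Delta_convolution:
  assumes "c > 0" "real_distribution P" "real_distribution M"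
  shows "mass_Delta c (convolution P M) x = conv_mass c P M UNIV x"
proof -
  interpret P: real_distribution P by fact
  interpret M: real_distribution M by fact
  have sp: "space (P \<Otimes>\<^sub>M M) = UNIV" by (simp add: space_pair_measure)
  show ?thesis
    unfolding mass_Delta_def convolution_def
    by (subst measure_distr)
       (auto simp: conv_mass_eq_measure[OF assms] sp intro!: arg_cong[where f = "measure _"])
qed

text \<open>
  By Fubini, the local mass can be integrated over either of the two summands. Exchanging their roles
  allows the two laws to be compared with \<open>H\<close> one after the other.
\<close>

lemma conv_mass_swap_le:
  assumes "c > 0" "real_distribution P" "real_distribution M"
    and "B \<in> sets borel" and B' [measurable]: "B' \<in> sets borel"
    and sub: "\<And>u v. u \<in> B \<Longrightarrow> x < u + v \<Longrightarrow> u + v \<le> x + c \<Longrightarrow> v \<in> B'"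
  shows "conv_mass c P M B x \<le> conv_mass c M P B' x"
proof -
  interpret P: real_distribution P by fact
  interpret M: real_distribution M by fact
  interpret PM: pair_prob_space P M ..
  interpret MP: pair_prob_space M P ..
  let ?S = "{(u, v). u \<in> B \<and> x < u + v \<and> u + v \<le> x + c}"
  let ?T = "{(u, v). u \<in> B' \<and> x < u + v \<and> u + v \<le> x + c}"
  have sp: "space (P \<Otimes>\<^sub>M M) = UNIV" by (simp add: space_pair_measure)
  have "measure (M \<Otimes>\<^sub>M P) ?T = measure (distr (P \<Otimes>\<^sub>M M) (M \<Otimes>\<^sub>M P) (\<lambda>(x, y). (y, x))) ?T"
    using MP.distr_pair_swap by simp
  also have "\<dots> = measure (P \<Otimes>\<^sub>M M) {(u, v). v \<in> B' \<and> x < u + v \<and> u + v \<le> x + c}"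
    by (subst measure_distr[OF _ sets_sum_strip(1)])
       (auto simp: sp add.commute intro!: arg_cong[where f = "measure _"])
  finally have *: "measure (M \<Otimes>\<^sub>M P) ?T
      = measure (P \<Otimes>\<^sub>M M) {(u, v). v \<in> B' \<and> x < u + v \<and> u + v \<le> x + c}" .
  have "measure (P \<Otimes>\<^sub>M M) ?S
      \<le> measure (P \<Otimes>\<^sub>M M) {(u, v). v \<in> B' \<and> x < u + v \<and> u + v \<le> x + c}"
    using sub by (intro PM.finite_measure_mono sets_sum_strip) auto
  then show ?thesis
    using assms by (simp add: conv_mass_eq_measure *)
qed

lemma conv_mass_mono_AE:
  assumes "c > 0" "real_distribution P" "real_distribution M" "real_distribution N"
    and "B \<in> sets borel"
    and "AE u in P. u \<in> B \<longrightarrow> mass_Delta c M (x - u) \<le> k * mass_Delta c N (x - u)"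
  shows "conv_mass c P M B x \<le> k * conv_mass c P N B x"
proof -
  have "conv_mass c P M B x \<le> (\<integral>u. k * (indicator B u * mass_Delta c N (x - u)) \<partial>P)"
    unfolding conv_mass_def using assms(6)
    by (intro integral_mono_AE integrable_mult_right conv_mass_integrable assms)
       (auto elim!: eventually_mono simp: indicator_def)
  then show ?thesis
    by (simp add: conv_mass_def)
qed

lemma conv_mass_le_const:
  assumes "c > 0" "real_distribution P" "real_distribution M"
    and B [measurable]: "B \<in> sets borel"
    and "AE u in P. u \<in> B \<longrightarrow> mass_Delta c M (x - u) \<le> k"
  shows "conv_mass c P M B x \<le> k * measure P B"
proof -
  interpret P: real_distribution P by fact
  have int: "integrable P (indicator B :: real \<Rightarrow> real)"
    by (rule P.integrable_const_bound[where B = 1]) auto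
  have "conv_mass c P M B x \<le> (\<integral>u. k * indicator B u \<partial>P)"
    unfolding conv_mass_def using assms(5)
    by (intro integral_mono_AE integrable_mult_right conv_mass_integrable assms int)
       (auto elim!: eventually_mono simp: indicator_def)
  then show ?thesis by simp
qed

lemma conv_mass_mono_set:
  assumes "c > 0" "real_distribution P" "real_distribution M"
    and "B \<in> sets borel" "B' \<in> sets borel" "B \<subseteq> B'"
  shows "conv_mass c P M B x \<le> conv_mass c P M B' x"
  unfolding conv_mass_def using assms
  by (intro integral_mono conv_mass_integrable) (auto simp: indicator_def)

lemma conv_mass_Un:
  assumes "c > 0" "real_distribution P" "real_distribution M"
    and "A \<in> sets borel" "B \<in> sets borel" "A \<inter> B = {}"
  shows "conv_mass c P M (A \<union> B) x = conv_mass c P M A x + conv_mass c P M B x"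
proof -
  have "(\<integral>u. indicator A u * mass_Delta c M (x - u) + indicator B u * mass_Delta c M (x - u) \<partial>P)
      = conv_mass c P M A x + conv_mass c P M B x"
    unfolding conv_mass_def
    by (intro Bochner_Integration.integral_add conv_mass_integrable assms)
  moreover have "indicator (A \<union> B) u * mass_Delta c M (x - u)
      = indicator A u * mass_Delta c M (x - u) + indicator B u * mass_Delta c M (x - u)" for u
    using assms(6) by (auto simp: indicator_def)
  ultimately show ?thesis
    by (simp add: conv_mass_def)
qed

lemma conv_mass_nonneg: "0 \<le> conv_mass c P M B x"
  by (simp add: conv_mass_def integral_nonneg_AE)

section \<open>Locally subexponential distributions\<close>

lemma filterlim_add_const_at_top: "filterlim (\<lambda>x. x + y :: real) at_top at_top"
  using filterlim_tendsto_add_at_top[OF tendsto_const[of y] filterlim_ident]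
  by (simp add: add.commute)

lemma eventually_le_of_ratio_tendsto:
  fixes f g :: "'a \<Rightarrow> real"
  assumes "((\<lambda>x. f x / g x) \<longlongrightarrow> m) F" "\<forall>\<^sub>F x in F. g x > 0"
  shows "\<forall>\<^sub>F x in F. f x \<le> (m + 1) * g x"
proof -
  have "\<forall>\<^sub>F x in F. f x / g x < m + 1"
    by (rule order_tendstoD(2)[OF assms(1)]) simp
  then show ?thesis
    using assms(2) by eventually_elim (simp add: field_simps)
qed

text \<open>
  The class is stated with \<open>\<sim>\<close> and with shifts to the right. Since local masses of \<open>H\<close> are positive
  near infinity, genuine quotients converge, and a shift to the left is undone by
  one to the right.
\<close>

lemma S_DeltaD:
  assumes "H \<in> S_Delta c"
  shows "real_distribution H"
    and "\<forall>\<^sub>F x in at_top. mass_Delta c H x > 0"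
    and "((\<lambda>x. mass_Delta c H (x + y) / mass_Delta c H x) \<longlongrightarrow> 1) at_top"
    and "((\<lambda>x. mass_Delta c (convolution H H) x / mass_Delta c H x) \<longlongrightarrow> 2) at_top"
proof -
  let ?h = "mass_Delta c H"
  show "real_distribution H"
    using assms by (simp add: S_Delta_def L_Delta_def)
  show pos: "\<forall>\<^sub>F x in at_top. ?h x > 0"
    using assms by (auto simp: S_Delta_def L_Delta_def class_L_def eventually_at_top_linorder)
  have right: "((\<lambda>x. ?h (x + y) / ?h x) \<longlongrightarrow> 1) at_top" if "y > 0" for y
  proof -
    have "(\<lambda>x. ?h (x + y)) \<sim>[at_top] ?h"
      using assms that by (auto simp: S_Delta_def L_Delta_def class_L_def)
    from asymp_equivD[OF this] show ?thesis
      by (rule Lim_transform_eventually) (use pos in \<open>auto elim!: eventually_mono\<close>)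
  qed
  show "((\<lambda>x. ?h (x + y) / ?h x) \<longlongrightarrow> 1) at_top"
  proof (cases y "0::real" rule: linorder_cases)
    case less
    have shift: "filterlim (\<lambda>x. x + y) at_top at_top"
      by (rule filterlim_add_const_at_top)
    have "((\<lambda>x. ?h (x + y + (- y)) / ?h (x + y)) \<longlongrightarrow> 1) at_top"
      using less by (intro filterlim_compose[OF right shift]) auto
    then have "((\<lambda>x. inverse (?h x / ?h (x + y))) \<longlongrightarrow> inverse 1) at_top"
      by (intro tendsto_inverse) auto
    then show ?thesis by simp
  next
    case equal
    have "\<forall>\<^sub>F x in at_top. 1 = ?h (x + y) / ?h x"
      using pos equal by (auto elim!: eventually_mono)
    then show ?thesis
      by (rule Lim_transform_eventually[OF tendsto_const])
  qed (rule right)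
  have "mass_Delta c (convolution H H) \<sim>[at_top] (\<lambda>x. 2 * ?h x)"
    using assms by (simp add: S_Delta_def)
  from asymp_equivD[OF this]
  have "((\<lambda>x. mass_Delta c (convolution H H) x / (2 * ?h x)) \<longlongrightarrow> 1) at_top"
    by (rule Lim_transform_eventually) (use pos in \<open>auto elim!: eventually_mono\<close>)
  from tendsto_mult[OF tendsto_const[of 2] this]
  show "((\<lambda>x. mass_Delta c (convolution H H) x / ?h x) \<longlongrightarrow> 2) at_top"
    by simp
qed

text \<open>
  A half-open interval of length \<open>c\<close> lies in the union of two neighbouring cells
  of the grid \<open>x + c \<int>\<close>, and for bounded \<open>t\<close> only finitely many cells occur, each of them having eventually
  at most twice the mass \<open>h x\<close>. So the pointwise shift property already
  yields a bound that is uniform in \<open>t\<close>.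
\<close>

lemma mass_Delta_shift_bound:
  assumes c: "c > 0" and H: "H \<in> S_Delta c"
  shows "\<forall>\<^sub>F x in at_top. \<forall>t. \<bar>t\<bar> \<le> B \<longrightarrow> mass_Delta c H (x + t) \<le> 4 * mass_Delta c H x"
proof -
  interpret H: real_distribution H by (rule S_DeltaD[OF H])
  let ?h = "mass_Delta c H"
  \<comment> \<open>The grid cells that meet a window at distance at most \<open>B\<close>.\<close>
  define K where "K = {\<lfloor>- B / c\<rfloor> .. \<lfloor>B / c\<rfloor> + 1}"
  have "\<forall>\<^sub>F x in at_top. \<forall>k\<in>K. ?h (x + k * c) \<le> 2 * ?h x"
  proof (rule eventually_ball_finite)
    show "\<forall>k\<in>K. \<forall>\<^sub>F x in at_top. ?h (x + k * c) \<le> 2 * ?h x"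
    proof
      fix k
      have "\<forall>\<^sub>F x in at_top. ?h (x + k * c) / ?h x < 2"
        by (rule order_tendstoD(2)[OF S_DeltaD(3)[OF H]]) simp
      then show "\<forall>\<^sub>F x in at_top. ?h (x + k * c) \<le> 2 * ?h x"
        using S_DeltaD(2)[OF H] by eventually_elim (simp add: field_simps)
    qed
  qed (simp add: K_def)
  then show ?thesis
  proof eventually_elim
    case (elim x)
    show ?case
    proof (intro allI impI)
      fix t assume t: "\<bar>t\<bar> \<le> B"
      define k where "k = \<lfloor>t / c\<rfloor>"
      have "- B / c \<le> t / c" "t / c \<le> B / c"
        using t c by (auto simp: field_simps)
      then have k: "k \<in> K" "k + 1 \<in> K"
        unfolding K_def k_def by (auto intro: floor_mono order.trans)
      have "k \<le> t / c" "t / c < k + 1"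
        by (auto simp: k_def)
      then have kt: "k * c \<le> t" "t < (k + 1) * c"
        using c by (auto simp: field_simps)
      have "?h (x + t) \<le> measure H ({x + k * c<..x + k * c + c} \<union> {x + (k + 1) * c<..x + (k + 1) * c + c})"
        unfolding mass_Delta_def
        by (rule H.finite_measure_mono) (use kt in \<open>auto simp: algebra_simps\<close>)
      also have "\<dots> \<le> ?h (x + k * c) + ?h (x + (k + 1) * c)"
        unfolding mass_Delta_def by (rule measure_Un_le) auto
      also have "\<dots> \<le> 4 * ?h x"
        using bspec[OF elim k(1)] bspec[OF elim k(2)] by simp
      finally show "?h (x + t) \<le> 4 * ?h x" .
    qed
  qed
qed

lemma D_DeltaE:
  assumes "H \<in> D_Delta c"
  obtains x0 K where "K \<ge> 1" "\<And>x z. x > x0 \<Longrightarrow> z \<ge> x \<Longrightarrow> mass_Delta c H z \<le> K * mass_Delta c H x"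
proof -
  obtain x0 K where K: "K > 0"
    "\<And>x y. x > x0 \<Longrightarrow> y > 0 \<Longrightarrow> mass_Delta c H (x + y) \<le> K * mass_Delta c H x"
    using assms by (auto simp: D_Delta_def almost_decreasing_def)
  show thesis
  proof
    show "max 1 K \<ge> 1" by simp
    fix x z assume "x > x0" "z \<ge> x"
    then show "mass_Delta c H z \<le> max 1 K * mass_Delta c H x"
      using K(2)[of x "z - x"] mult_right_mono[of K "max 1 K" "mass_Delta c H x"]
        mult_right_mono[of 1 "max 1 K" "mass_Delta c H x"]
      by (cases "z = x") auto
  qed
qed

lemma prob_concentrated_on_interval:
  assumes "real_distribution P" "e > 0"
  shows "\<exists>A0. \<forall>A\<ge>A0. measure P {- A..A} > 1 - e"
proof -
  interpret P: real_distribution P by fact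
  have "(\<lambda>n. measure P {- real n..real n}) \<longlonglongrightarrow> measure P (\<Union>n. {- real n..real n})"
    by (rule P.finite_Lim_measure_incseq) (auto simp: incseq_def)
  also have "(\<Union>n. {- real n..real n}) = UNIV"
  proof (intro set_eqI iffI UNIV_I)
    fix x :: real
    obtain n where "\<bar>x\<bar> \<le> real n" using real_arch_simple by blast
    then show "x \<in> (\<Union>n. {- real n..real n})" by (auto simp: abs_le_iff intro!: exI[of _ n])
  qed
  also have "measure P UNIV = 1" using P.prob_space by simp
  finally have "\<forall>\<^sub>F n in sequentially. measure P {- real n..real n} > 1 - e"
    by (rule order_tendstoD(1)) (use \<open>e > 0\<close> in simp)
  then obtain n where n: "measure P {- real n..real n} > 1 - e"
    by (auto simp: eventually_sequentially)
  have "measure P {- real n..real n} \<le> measure P {- A..A}" if "A \<ge> real n" for A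
    using that by (intro P.finite_measure_mono) auto
  with n show ?thesis by force
qed

text \<open>
  Shifts of bounded size do not change local masses asymptotically. The shift bound above provides the
  dominating constant, so dominated convergence applies.
\<close>

lemma conv_mass_bounded_part_tendsto:
  assumes c: "c > 0" and P: "real_distribution P" and M: "real_distribution M"
    and H: "H \<in> S_Delta c"
    and lim: "((\<lambda>x. mass_Delta c M x / mass_Delta c H x) \<longlongrightarrow> m) at_top"
  shows "((\<lambda>x. conv_mass c P M {- A..A} x / mass_Delta c H x) \<longlongrightarrow> m * measure P {- A..A}) at_top"
proof -
  interpret P: real_distribution P by fact
  let ?h = "mass_Delta c H"
  note [measurable] = borel_measurable_mass_Delta[OF c M]
  have shift: "filterlim (\<lambda>x. x - u) at_top at_top" for u :: real
    using filterlim_add_const_at_top[of "- u"] by simp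
  have m1: "\<forall>\<^sub>F x in at_top. mass_Delta c M x \<le> (m + 1) * ?h x"
    by (rule eventually_le_of_ratio_tendsto[OF lim S_DeltaD(2)[OF H]])
  then obtain z0 where z0: "\<And>z. z \<ge> z0 \<Longrightarrow> mass_Delta c M z \<le> (m + 1) * ?h z"
    by (auto simp: eventually_at_top_linorder)
  have m0: "m \<ge> 0"
    by (rule tendsto_lowerbound[OF lim]) auto
  have "((\<lambda>x. \<integral>u. indicator {- A..A} u * mass_Delta c M (x - u) / ?h x \<partial>P)
      \<longlongrightarrow> (\<integral>u. indicator {- A..A} u * m \<partial>P)) at_top"
  proof (rule integral_dominated_convergence_at_top[where w = "\<lambda>_. 4 * (m + 1)"])
    show "\<forall>\<^sub>F x in at_top. AE u in P.
        norm (indicator {- A..A} u * mass_Delta c M (x - u) / ?h x) \<le> 4 * (m + 1)"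
      using mass_Delta_shift_bound[OF c H, of A] S_DeltaD(2)[OF H] eventually_ge_at_top[of "z0 + A"]
    proof eventually_elim
      case (elim x)
      have "mass_Delta c M (x - u) / ?h x \<le> 4 * (m + 1)" if "- A \<le> u" "u \<le> A" for u
      proof -
        have "mass_Delta c M (x - u) \<le> (m + 1) * ?h (x - u)"
          using that elim by (intro z0) auto
        also have "\<dots> \<le> (m + 1) * (4 * ?h x)"
          using elim(1)[rule_format, of "- u"] that m0 by (intro mult_left_mono) auto
        finally show ?thesis using elim(2) by (simp add: field_simps)
      qed
      then show ?case
        using m0 by (auto simp: indicator_def abs_mult)
    qed
    show "AE u in P. ((\<lambda>x. indicator {- A..A} u * mass_Delta c M (x - u) / ?h x)
        \<longlongrightarrow> indicator {- A..A} u * m) at_top"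
    proof (rule AE_I2)
      fix u
      have "((\<lambda>x. mass_Delta c M (x - u) / ?h (x - u) * (?h (x + (- u)) / ?h x)) \<longlongrightarrow> m * 1) at_top"
        by (intro tendsto_mult S_DeltaD(3)[OF H] filterlim_compose[OF lim shift])
      moreover have "\<forall>\<^sub>F x in at_top. mass_Delta c M (x - u) / ?h (x - u) * (?h (x + (- u)) / ?h x)
          = mass_Delta c M (x - u) / ?h x"
        using filterlim_iff[THEN iffD1, OF shift[of u], rule_format, OF S_DeltaD(2)[OF H]]
        by (auto elim!: eventually_mono)
      ultimately have "((\<lambda>x. mass_Delta c M (x - u) / ?h x) \<longlongrightarrow> m) at_top"
        using Lim_transform_eventually by fastforce
      from tendsto_mult[OF tendsto_const[of "indicator {- A..A} u"] this]
      show "((\<lambda>x. indicator {- A..A} u * mass_Delta c M (x - u) / ?h x)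
        \<longlongrightarrow> indicator {- A..A} u * m) at_top" by simp
    qed
  qed auto
  then show ?thesis
    by (simp add: conv_mass_def mult.commute)
qed

text \<open>
  Let \<open>U\<close> and \<open>V\<close> be independent with laws \<open>P\<close> and \<open>M\<close>, and cut \<open>U + V \<in> x + \<Delta>\<close> according to \<open>U\<close>, for a
  large constant \<open>A\<close>.

  \<^item> If \<open>- A \<le> U \<le> A\<close>, the contribution is asymptotically \<open>m\<close> times \<open>P {- A..A}\<close>, which is nearly \<open>m\<close>.
  \<^item> If \<open>A < U \<le> x - A\<close>, both summands are large. One replaces \<open>M\<close> by a multiple of \<open>H\<close>, changes
    the order of integration, and replaces \<open>P\<close> by \<open>e\<close> times \<open>H\<close>; what results is at most \<open>e\<close> times
    the local mass of \<open>H * H\<close>, which is \<open>O(h)\<close>.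
  \<^item> If \<open>U > x - A\<close>, then \<open>V < A + c\<close>. Integrating over \<open>V\<close>, the local mass of \<open>P\<close>
    near \<open>x - V\<close> is at most \<open>e * h (x - V)\<close>.
  \<^item> If \<open>U < - A\<close>, the local mass of \<open>M\<close> near \<open>x - U\<close> is at most a multiple of \<open>h (x - U)\<close>, and
    the event \<open>U < - A\<close> itself has small probability.

  In the last two cases \<open>h\<close> is evaluated arbitrarily far to the right of \<open>x\<close>: one needs that \<open>h\<close>
  is almost decreasing, or that no such shift occurs because both laws live on the half-line.
\<close>

lemma convolution_locally_small_tendsto:
  assumes c: "c > 0" and P: "real_distribution P" and M: "real_distribution M"
    and H: "H \<in> S_Delta c"
    and side: "H \<in> D_Delta c \<or> (on_nonneg P \<and> on_nonneg M)"
    and small: "mass_Delta c P \<in> o[at_top](mass_Delta c H)"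
    and lim: "((\<lambda>x. mass_Delta c M x / mass_Delta c H x) \<longlongrightarrow> m) at_top"
  shows "((\<lambda>x. mass_Delta c (convolution P M) x / mass_Delta c H x) \<longlongrightarrow> m) at_top"
proof -
  interpret P: real_distribution P by fact
  let ?h = "mass_Delta c H"
  note Hd = S_DeltaD(1)[OF H]
  have m0: "m \<ge> 0"
    by (rule tendsto_lowerbound[OF lim]) auto
  have m1: "\<forall>\<^sub>F x in at_top. mass_Delta c M x \<le> (m + 1) * ?h x"
    by (rule eventually_le_of_ratio_tendsto[OF lim S_DeltaD(2)[OF H]])
  obtain x0 K where K1: "K \<ge> 1" and side':
      "(\<forall>x z. x > x0 \<longrightarrow> z \<ge> x \<longrightarrow> ?h z \<le> K * ?h x) \<or> ((AE u in P. 0 \<le> u) \<and> (AE u in M. 0 \<le> u))"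
  proof (cases "H \<in> D_Delta c")
    case True
    then show thesis using that by (elim D_DeltaE) blast
  next
    case False
    then show thesis
      using that[of 1] side P M by (auto simp: on_nonneg_iff_AE)
  qed
  \<comment> \<open>The sum of the constants of all error terms below, each of which is proportional to \<open>e\<close>.\<close>
  define C where "C = 1 + 2 * m + 3 * (m + 1) + 4 * K + (m + 1) * K"
  have C: "C > 0"
    unfolding C_def using m0 K1 by (intro add_pos_nonneg mult_nonneg_nonneg) auto
  have main: "\<forall>\<^sub>F x in at_top. \<bar>mass_Delta c (convolution P M) x / ?h x - m\<bar> < C * e"
    if e: "e > 0" for e
  proof -
    have "\<forall>\<^sub>F z in at_top. mass_Delta c P z \<le> e * ?h z"
      using landau_o.smallD[OF small e] by simp
    with m1 have "\<forall>\<^sub>F z in at_top. mass_Delta c M z \<le> (m + 1) * ?h z \<and> mass_Delta c P z \<le> e * ?h z"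
      by (rule eventually_conj)
    then obtain z0 where z0: "\<And>z. z \<ge> z0 \<Longrightarrow> mass_Delta c M z \<le> (m + 1) * ?h z"
      "\<And>z. z \<ge> z0 \<Longrightarrow> mass_Delta c P z \<le> e * ?h z"
      by (auto simp: eventually_at_top_linorder)
    obtain A0 where A0: "\<And>A. A \<ge> A0 \<Longrightarrow> measure P {- A..A} > 1 - e"
      using prob_concentrated_on_interval[OF P e] by blast
    \<comment> \<open>In the second case below, the arguments at which \<open>P\<close> is compared with \<open>H\<close> are only at least
      \<open>A - c\<close>, whence the summand \<open>c\<close>.\<close>
    define A where "A = max (max 1 A0) (max z0 x0 + c)"
    have A: "A > 0" "A - c \<ge> z0" "measure P {- A..A} > 1 - e"
      using A0[of A] by (auto simp: A_def)
    have left_le: "measure P {..<- A} \<le> e"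
    proof -
      have "measure P {..<- A} \<le> measure P (space P - {- A..A})"
        by (rule P.finite_measure_mono) (use A in auto)
      also have "\<dots> = 1 - measure P {- A..A}"
        by (rule P.prob_compl) simp
      finally show ?thesis using A by simp
    qed
    have T1: "\<forall>\<^sub>F x in at_top.
        \<bar>conv_mass c P M {- A..A} x / ?h x - m * measure P {- A..A}\<bar> < e"
      using tendstoD[OF conv_mass_bounded_part_tendsto[OF c P M H lim] e]
      by (simp add: dist_real_def)
    have T2: "\<forall>\<^sub>F x in at_top. conv_mass c P M {A<..x - A} x \<le> 3 * (m + 1) * e * ?h x"
    proof -
      have "\<forall>\<^sub>F x in at_top. mass_Delta c (convolution H H) x / ?h x < 3"
        by (rule order_tendstoD(2)[OF S_DeltaD(4)[OF H]]) simp
      then show ?thesis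
        using S_DeltaD(2)[OF H]
      proof eventually_elim
        case (elim x)
        have "conv_mass c P H {A<..x - A} x \<le> conv_mass c H P {..x - A + c} x"
          using A by (intro conv_mass_swap_le c P Hd) auto
        also have "\<dots> \<le> e * conv_mass c H H {..x - A + c} x"
          using A by (intro conv_mass_mono_AE c P Hd AE_I2) (auto intro!: z0)
        also have "conv_mass c H H {..x - A + c} x \<le> conv_mass c H H UNIV x"
          by (intro conv_mass_mono_set c Hd) auto
        also have "\<dots> = mass_Delta c (convolution H H) x"
          using mass_Delta_convolution[OF c Hd Hd] by simp
        also have "\<dots> \<le> 3 * ?h x"
          using elim by (simp add: field_simps)
        finally have "conv_mass c P H {A<..x - A} x \<le> e * (3 * ?h x)"
          using e by simp
        then have "(m + 1) * conv_mass c P H {A<..x - A} x \<le> (m + 1) * (e * (3 * ?h x))"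
          using m0 by (intro mult_left_mono) auto
        moreover have "conv_mass c P M {A<..x - A} x \<le> (m + 1) * conv_mass c P H {A<..x - A} x"
          using A c by (intro conv_mass_mono_AE c P M Hd AE_I2) (auto intro!: z0)
        moreover have "(m + 1) * (e * (3 * ?h x)) = 3 * (m + 1) * e * ?h x"
          by algebra
        ultimately show ?case by linarith
      qed
    qed
    have T3: "\<forall>\<^sub>F x in at_top. conv_mass c P M {x - A<..} x \<le> 4 * K * e * ?h x"
      using mass_Delta_shift_bound[OF c H, of "A + c"] S_DeltaD(2)[OF H]
        eventually_gt_at_top[of "z0 + A + c"] eventually_gt_at_top[of "x0 + A + c"]
    proof eventually_elim
      case (elim x)
      interpret M: real_distribution M by fact
      have h4: "?h (x - v) \<le> 4 * ?h x" if "\<bar>v\<bar> \<le> A + c" for v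
        using elim(1)[rule_format, of "- v"] that by auto
      have h4K: "?h (x - v) \<le> 4 * K * ?h x" if "\<bar>v\<bar> \<le> A + c" for v
      proof -
        have "?h (x - v) \<le> 4 * ?h x"
          by (rule h4[OF that])
        also have "\<dots> \<le> 4 * K * ?h x"
          using K1 elim(2) by simp
        finally show ?thesis .
      qed
      have "AE v in M. v \<in> {..<A + c} \<longrightarrow> ?h (x - v) \<le> 4 * K * ?h x"
        using side'
      proof
        assume *: "\<forall>x z. x > x0 \<longrightarrow> z \<ge> x \<longrightarrow> ?h z \<le> K * ?h x"
        have "?h (x - v) \<le> 4 * K * ?h x" if "v < A + c" for v
        proof -
          have "?h (x - v) \<le> K * ?h (x - (A + c))"
            using elim that by (intro *[rule_format]) auto
          also have "\<dots> \<le> K * (4 * ?h x)"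
            using A c K1 by (intro mult_left_mono h4) auto
          finally show ?thesis by (simp add: mult_ac)
        qed
        then show ?thesis by simp
      next
        assume "(AE u in P. 0 \<le> u) \<and> (AE u in M. 0 \<le> u)"
        then show ?thesis
          using h4K A c by (auto elim!: eventually_mono)
      qed
      then have *: "AE v in M. v \<in> {..<A + c} \<longrightarrow> mass_Delta c P (x - v) \<le> e * (4 * K * ?h x)"
      proof eventually_elim
        case (elim v)
        show ?case
        proof
          assume v: "v \<in> {..<A + c}"
          then have "mass_Delta c P (x - v) \<le> e * ?h (x - v)"
            using \<open>z0 + A + c < x\<close> by (intro z0) auto
          also have "\<dots> \<le> e * (4 * K * ?h x)"
            using elim v e by (intro mult_left_mono) auto
          finally show "mass_Delta c P (x - v) \<le> e * (4 * K * ?h x)" .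
        qed
      qed
      have "conv_mass c P M {x - A<..} x \<le> conv_mass c M P {..<A + c} x"
        by (intro conv_mass_swap_le c P M) auto
      also have "\<dots> \<le> e * (4 * K * ?h x) * measure M {..<A + c}"
        by (intro conv_mass_le_const c P M *) auto
      also have "\<dots> \<le> e * (4 * K * ?h x) * 1"
        using e K1 elim(2) by (intro mult_left_mono) auto
      finally show ?case by (simp add: mult_ac)
    qed
    have T4: "\<forall>\<^sub>F x in at_top. conv_mass c P M {..<- A} x \<le> (m + 1) * K * e * ?h x"
      using S_DeltaD(2)[OF H] eventually_gt_at_top[of x0] eventually_gt_at_top[of z0]
    proof eventually_elim
      case (elim x)
      have "AE u in P. u \<in> {..<- A} \<longrightarrow> mass_Delta c M (x - u) \<le> (m + 1) * K * ?h x"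
        using side'
      proof
        assume *: "\<forall>x z. x > x0 \<longrightarrow> z \<ge> x \<longrightarrow> ?h z \<le> K * ?h x"
        have "mass_Delta c M (x - u) \<le> (m + 1) * K * ?h x" if "u < - A" for u
        proof -
          have "mass_Delta c M (x - u) \<le> (m + 1) * ?h (x - u)"
            using A elim that by (intro z0) auto
          also have "\<dots> \<le> (m + 1) * (K * ?h x)"
            using A elim that m0 by (intro mult_left_mono *[rule_format]) auto
          finally show ?thesis by (simp add: mult_ac)
        qed
        then show ?thesis by simp
      next
        assume "(AE u in P. 0 \<le> u) \<and> (AE u in M. 0 \<le> u)"
        then show ?thesis
          using A by (auto elim!: eventually_mono)
      qed
      then have "conv_mass c P M {..<- A} x \<le> (m + 1) * K * ?h x * measure P {..<- A}"
        by (intro conv_mass_le_const c P M) auto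
      also have "\<dots> \<le> (m + 1) * K * ?h x * e"
        using left_le m0 K1 elim by (intro mult_left_mono) auto
      finally show ?case by (simp add: mult_ac)
    qed
    show ?thesis
      using T1 T2 T3 T4 S_DeltaD(2)[OF H] eventually_gt_at_top[of "2 * A"]
    proof eventually_elim
      case (elim x)
      define t1 t2 t3 t4 where "t1 = conv_mass c P M {- A..A} x / ?h x"
        and "t2 = conv_mass c P M {A<..x - A} x / ?h x"
        and "t3 = conv_mass c P M {x - A<..} x / ?h x"
        and "t4 = conv_mass c P M {..<- A} x / ?h x"
      have "UNIV = (({..<- A} \<union> {- A..A}) \<union> {A<..x - A}) \<union> {x - A<..}"
        using A elim(6) by auto
      then have "conv_mass c P M UNIV x
          = conv_mass c P M ((({..<- A} \<union> {- A..A}) \<union> {A<..x - A}) \<union> {x - A<..}) x"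
        by simp
      also have "\<dots> = conv_mass c P M {..<- A} x + conv_mass c P M {- A..A} x
          + conv_mass c P M {A<..x - A} x + conv_mass c P M {x - A<..} x"
      proof -
        have "({..<- A} \<union> {- A..A} \<union> {A<..x - A}) \<inter> {x - A<..} = {}"
          "({..<- A} \<union> {- A..A}) \<inter> {A<..x - A} = {}" "{..<- A} \<inter> {- A..A} = {}"
          using A elim(6) by auto
        then show ?thesis
          by (subst conv_mass_Un[OF c P M], simp, simp, simp only:)+ simp
      qed
      finally have sum: "mass_Delta c (convolution P M) x / ?h x = t4 + t1 + t2 + t3"
        by (simp add: mass_Delta_convolution[OF c P M] t1_def t2_def t3_def t4_def add_divide_distrib)
      have b1: "\<bar>t1 - m * measure P {- A..A}\<bar> < e"
        using elim(1) by (simp add: t1_def)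
      have b2: "0 \<le> t2" "t2 \<le> 3 * (m + 1) * e"
        using elim(2,5) by (auto simp: t2_def field_simps conv_mass_nonneg)
      have b3: "0 \<le> t3" "t3 \<le> 4 * K * e"
        using elim(3,5) by (auto simp: t3_def field_simps conv_mass_nonneg)
      have b4: "0 \<le> t4" "t4 \<le> (m + 1) * K * e"
        using elim(4,5) by (auto simp: t4_def field_simps conv_mass_nonneg)
      have "m * (1 - measure P {- A..A}) \<le> m * e" "m * (1 - measure P {- A..A}) \<ge> 0"
        using A m0 by (auto intro!: mult_left_mono)
      moreover have "C * e = e + 2 * (m * e) + 3 * (m + 1) * e + 4 * K * e + (m + 1) * K * e"
        by (simp add: C_def algebra_simps)
      moreover have "m * e \<ge> 0" "3 * (m + 1) * e \<ge> 0" "4 * K * e \<ge> 0" "(m + 1) * K * e \<ge> 0"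
        using m0 e K1 by auto
      moreover have "m * (1 - measure P {- A..A}) = m - m * measure P {- A..A}"
        by (simp add: algebra_simps)
      ultimately show ?case
        unfolding sum using b1 b2 b3 b4 by linarith
    qed
  qed
  show ?thesis
  proof (rule tendstoI)
    fix e :: real assume "e > 0"
    then have "e / C > 0" using C by simp
    from main[OF this] show "\<forall>\<^sub>F x in at_top. dist (mass_Delta c (convolution P M) x / ?h x) m < e"
      using C by (simp add: dist_real_def)
  qed
qed

section \<open>Two facts about series\<close>

text \<open>
  In terms of the shift \<open>S\<close> on bounded sequences this is \<open>exp (- r S) (exp (r S) q) = q\<close>, evaluated at \<open>0\<close>.
  The double series converges absolutely; summed along the diagonals \<open>n + k = s\<close> it yields
  \<open>q s * (- r + r) ^ s / fact s\<close> by the binomial theorem.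
\<close>

lemma signed_poisson_inverts_poisson:
  fixes q :: "nat \<Rightarrow> real" and r :: real
  assumes r: "r > 0" and q: "\<And>s. \<bar>q s\<bar> \<le> 1"
  shows "(\<lambda>n. (- r) ^ n / fact n * (\<Sum>k. r ^ k / fact k * q (n + k))) sums q 0"
proof -
  define f where "f = (\<lambda>(n, k). ((- r) ^ n / fact n) * (r ^ k / fact k * q (n + k)))"
  define g where "g = (\<lambda>n. r ^ n / fact n)"
  have g: "g sums exp r"
    using exp_converges[of r] by (simp add: g_def divide_inverse mult.commute)
  have g0: "g n \<ge> 0" for n
    using r by (simp add: g_def)
  have ghs: "(g has_sum exp r) UNIV"
    using g g0 by (rule sums_nonneg_imp_has_sum)
  have abs_g: "(\<lambda>p. norm (case p of (n, k) \<Rightarrow> g n * g k)) summable_on (UNIV \<times> UNIV)"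
  proof -
    have 1: "(\<lambda>k. g n * g k) summable_on UNIV" for n
      using ghs has_sum_imp_summable summable_on_cmult_right by blast
    have 2: "(\<Sum>\<^sub>\<infinity>k. g n * g k) = g n * exp r" for n
      using has_sum_cmult_right[OF ghs, of "g n"] by (rule infsumI)
    have 3: "(\<lambda>n. g n * exp r) summable_on UNIV"
      using ghs has_sum_imp_summable summable_on_cmult_left by blast
    show ?thesis
      by (subst Infinite_Sum.abs_summable_on_Sigma_iff) (use 1 2 3 g0 in \<open>simp add: abs_mult\<close>)
  qed
  have f_le: "\<bar>f p\<bar> \<le> g (fst p) * g (snd p)" for p
  proof -
    have "\<bar>f p\<bar> = g (fst p) * g (snd p) * \<bar>q (fst p + snd p)\<bar>"
      using r by (simp add: f_def g_def case_prod_beta abs_mult power_abs)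
    also have "\<dots> \<le> g (fst p) * g (snd p) * 1"
      using q g0 by (intro mult_left_mono) auto
    finally show ?thesis by simp
  qed
  have "(\<lambda>p. norm (f p)) summable_on (UNIV \<times> UNIV)"
    by (rule Infinite_Sum.abs_summable_on_comparison_test[OF abs_g])
       (use f_le g0 in \<open>auto simp: case_prod_beta abs_mult\<close>)
  then obtain S where S: "(f has_sum S) (UNIV \<times> UNIV)"
    using abs_summable_summable has_sum_infsum by blast
  have inner: "((\<lambda>k. f (n, k)) has_sum (- r) ^ n / fact n * (\<Sum>k. r ^ k / fact k * q (n + k))) UNIV"
    for n
  proof -
    have sm: "summable (\<lambda>k. norm (r ^ k / fact k * q (n + k)))"
    proof (rule summable_comparison_test')
      show "summable g" using g by (rule sums_summable)
      show "norm (norm (r ^ k / fact k * q (n + k))) \<le> g k" for k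
        using mult_left_mono[OF q[of "n + k"] g0[of k]] r
        by (simp add: g_def abs_mult)
    qed
    have "((\<lambda>k. r ^ k / fact k * q (n + k)) has_sum (\<Sum>k. r ^ k / fact k * q (n + k))) UNIV"
      by (rule norm_summable_imp_has_sum[OF sm summable_sums[OF summable_norm_cancel[OF sm]]])
    then show ?thesis
      unfolding f_def prod.case by (rule has_sum_cmult_right)
  qed
  have outer: "((\<lambda>n. (- r) ^ n / fact n * (\<Sum>k. r ^ k / fact k * q (n + k))) has_sum S) UNIV"
    using S inner by (rule has_sum_SigmaD)
  have S': "((\<lambda>(s, i). f (i, s - i)) has_sum S) (Sigma UNIV (\<lambda>s. {..s}))"
    using S
    by (subst has_sum_reindex_bij_witness[where T = "UNIV \<times> UNIV"
          and i = "\<lambda>(i, k). (i + k, i)" and j = "\<lambda>(s, i). (i, s - i)" and h = f]) auto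
  have diag: "(\<Sum>i\<le>s. f (i, s - i)) = (if s = 0 then q 0 else 0)" for s
  proof -
    have "(\<Sum>i\<le>s. f (i, s - i)) = q s / fact s * (\<Sum>i\<le>s. of_nat (s choose i) * (- r) ^ i * r ^ (s - i))"
      unfolding sum_distrib_left f_def
      by (intro sum.cong) (auto simp: binomial_fact)
    also have "\<dots> = q s / fact s * (- r + r) ^ s"
      by (simp only: binomial_ring)
    also have "\<dots> = (if s = 0 then q 0 else 0)"
      by simp
    finally show ?thesis .
  qed
  have "((\<lambda>s. if s = (0::nat) then q 0 else 0) has_sum S) UNIV"
    using S' by (rule has_sum_SigmaD) (auto simp: diag[symmetric] intro!: has_sum_finite)
  moreover have "((\<lambda>s. if s = (0::nat) then q 0 else 0) has_sum q 0) UNIV"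
    using has_sum_finite[of "{0::nat}" "\<lambda>s. if s = (0::nat) then q 0 else 0"]
    by (subst has_sum_cong_neutral[where S = UNIV and T = "{0}"]) auto
  ultimately have "S = q 0"
    by (rule has_sum_unique)
  with outer show ?thesis
    by (simp add: has_sum_imp_sums)
qed

text \<open>
  Scheffe's argument: for non-negative terms, termwise convergence together with convergence of the
  sums to the sum of the limits makes the tails uniformly small, and these tails bound those of the alternating
  series.
\<close>

lemma tendsto_alternating_suminf:
  fixes a :: "'a \<Rightarrow> nat \<Rightarrow> real" and b :: "nat \<Rightarrow> real"
  assumes a0: "\<forall>\<^sub>F x in F. \<forall>n. a x n \<ge> 0" 
    and tot: "\<forall>\<^sub>F x in F. a x sums A x"
    and lim: "\<And>n. ((\<lambda>x. a x n) \<longlongrightarrow> b n) F"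
    and b0: "\<And>n. b n \<ge> 0" and b: "b sums l" and A: "(A \<longlongrightarrow> l) F"
  shows "((\<lambda>x. \<Sum>n. (- 1) ^ n * a x n) \<longlongrightarrow> (\<Sum>n. (- 1) ^ n * b n)) F"
proof (rule tendstoI)
  fix e :: real assume e: "e > 0"
  have tail: "\<bar>(\<Sum>n. (- 1) ^ n * t n) - (\<Sum>n<N. (- 1) ^ n * t n)\<bar> \<le> T - sum t {..<N}"
    if t0: "\<And>n. t n \<ge> 0" and T: "t sums T" for t :: "nat \<Rightarrow> real" and T N
  proof -
    have st: "summable t" using T by (rule sums_summable)
    have s: "summable (\<lambda>n. \<bar>(- 1) ^ n * t n\<bar>)"
      using st t0 by (simp add: abs_mult power_abs)
    have s': "summable (\<lambda>n. (- 1) ^ n * t n)"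
      by (rule summable_rabs_cancel[OF s])
    have "(\<Sum>n. (- 1) ^ n * t n) - (\<Sum>n<N. (- 1) ^ n * t n) = (\<Sum>n. (- 1) ^ (n + N) * t (n + N))"
      using suminf_split_initial_segment[OF s', of N] by simp
    also have "\<bar>\<dots>\<bar> \<le> (\<Sum>n. \<bar>(- 1) ^ (n + N) * t (n + N)\<bar>)"
      by (rule summable_rabs) (use summable_ignore_initial_segment[OF s, of N] in simp)
    also have "\<dots> = (\<Sum>n. t (n + N))"
      using t0 by (simp add: abs_mult power_abs)
    also have "\<dots> = T - sum t {..<N}"
      using suminf_split_initial_segment[OF st, of N] T by (simp add: sums_iff)
    finally show ?thesis .
  qed
  have "(\<lambda>N. sum b {..<N}) \<longlonglongrightarrow> l"
    using b by (simp add: sums_def)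
  then obtain N where N: "\<bar>sum b {..<N} - l\<bar> < e / 4"
    using LIMSEQ_D[of "\<lambda>N. sum b {..<N}" l "e / 4"] e by auto
  have "((\<lambda>x. A x - sum (a x) {..<N}) \<longlongrightarrow> l - sum b {..<N}) F"
    by (intro tendsto_intros A lim)
  moreover have b_tail: "l - sum b {..<N} < e / 4"
    using N by linarith
  ultimately have 1: "\<forall>\<^sub>F x in F. A x - sum (a x) {..<N} < e / 4"
    by (rule order_tendstoD(2))
  have "((\<lambda>x. \<Sum>n<N. (- 1) ^ n * a x n) \<longlongrightarrow> (\<Sum>n<N. (- 1) ^ n * b n)) F"
    by (intro tendsto_intros lim)
  then have 2: "\<forall>\<^sub>F x in F. dist (\<Sum>n<N. (- 1) ^ n * a x n) (\<Sum>n<N. (- 1) ^ n * b n) < e / 4"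
    using e by (intro tendstoD) auto
  show "\<forall>\<^sub>F x in F. dist (\<Sum>n. (- 1) ^ n * a x n) (\<Sum>n. (- 1) ^ n * b n) < e"
    using 1 2 a0 tot
  proof eventually_elim
    case (elim x)
    show ?case
      using tail[OF elim(3)[rule_format] elim(4), of N] tail[OF b0 b, of N] elim(1,2) b_tail
      unfolding dist_real_def by linarith
  qed
qed

section \<open>Inverting the convolution with a compound Poisson distribution\<close>

text \<open>The rate and the jump law are exposed here, since the inverse is built from them.\<close>

definition compound_poisson_with :: "real \<Rightarrow> real measure \<Rightarrow> real measure \<Rightarrow> bool" where
  "compound_poisson_with r Q G \<longleftrightarrow> r > 0 \<and> real_distribution Q \<and> real_distribution G \<and>
     (\<forall>A \<in> sets borel.
        (\<lambda>n. exp (- r) * (r ^ n / fact n) * measure (conv_power Q n) A) sums measure G A)"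

lemma compound_poisson_withD:
  assumes "compound_poisson_with r Q G"
  shows "r > 0" "real_distribution Q" "real_distribution G"
    and "\<And>A. A \<in> sets borel \<Longrightarrow>
      (\<lambda>n. exp (- r) * (r ^ n / fact n) * measure (conv_power Q n) A) sums measure G A"
  using assms by (auto simp: compound_poisson_with_def)

lemma compound_poisson_term_le:
  assumes G: "compound_poisson_with r Q G" and A: "A \<in> sets borel"
  shows "exp (- r) * (r ^ n / fact n) * measure (conv_power Q n) A \<le> measure G A"
proof -
  note s = compound_poisson_withD(4)[OF G A] and r = compound_poisson_withD(1)[OF G]
  have "(\<Sum>k\<in>{n}. exp (- r) * (r ^ k / fact k) * measure (conv_power Q k) A)
      \<le> (\<Sum>k. exp (- r) * (r ^ k / fact k) * measure (conv_power Q k) A)"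
    using s r by (intro sum_le_suminf) (auto simp: sums_iff)
  then show ?thesis
    using s by (simp add: sums_iff)
qed

lemma compound_poisson_convolution_sums:
  assumes G: "compound_poisson_with r Q G" and M: "real_distribution M" and A: "A \<in> sets borel"
  shows "(\<lambda>n. exp (- r) * (r ^ n / fact n) * measure (convolution (conv_power Q n) M) A)
    sums measure (convolution G M) A"
proof -
  interpret M: real_distribution M by fact
  note r = compound_poisson_withD(1)[OF G] and Gd = compound_poisson_withD(3)[OF G]
  note Qd = real_distribution_conv_power[OF compound_poisson_withD(2)[OF G]]
  have shift [measurable]: "{x. x + y \<in> A} \<in> sets borel" for y
  proof -
    have "(\<lambda>x. x + y) -` A \<inter> space borel \<in> sets borel"
      using A by measurable
    then show ?thesis by (simp add: vimage_def)
  qed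
  define w where "w n y = exp (- r) * (r ^ n / fact n) * measure (conv_power Q n) {x. x + y \<in> A}"
    for n y
  have w0: "w n y \<ge> 0" for n y
    using r by (simp add: w_def)
  have ws: "(\<lambda>n. w n y) sums measure G {x. x + y \<in> A}" for y
    unfolding w_def by (rule compound_poisson_withD(4)[OF G shift])
  have wi: "integrable M (w n)" for n
    unfolding w_def by (intro integrable_mult_right measure_convolution(2) Qd M A)
  have wI: "(\<integral>y. w n y \<partial>M)
      = exp (- r) * (r ^ n / fact n) * measure (convolution (conv_power Q n) M) A" for n
    unfolding w_def by (simp add: measure_convolution(1)[OF Qd M A])
  have "(\<lambda>n. \<integral>y. w n y \<partial>M) sums (\<integral>y. (\<Sum>n. w n y) \<partial>M)"
  proof (rule sums_integral[OF wi])
    show "AE y in M. summable (\<lambda>n. norm (w n y))"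
      using ws w0 by (auto simp: sums_iff)
    have sg: "summable (\<lambda>n. exp (- r) * (r ^ n / fact n))"
      using summable_mult[OF summable_exp[of r], of "exp (- r)"]
      by (simp add: divide_inverse mult_ac)
    show "summable (\<lambda>n. \<integral>y. norm (w n y) \<partial>M)"
    proof (rule summable_comparison_test'[OF sg])
      fix n
      interpret C: real_distribution "convolution (conv_power Q n) M"
        by (rule real_distribution_convolution[OF Qd M])
      have "(\<integral>y. norm (w n y) \<partial>M) = (\<integral>y. w n y \<partial>M)"
        using w0 by simp
      then show "norm (\<integral>y. norm (w n y) \<partial>M) \<le> exp (- r) * (r ^ n / fact n)"
        using r wI[of n] mult_left_mono[OF C.prob_le_1[of A], of "exp (- r) * (r ^ n / fact n)"]
        by simp
    qed
  qed
  also have "(\<lambda>y. \<Sum>n. w n y) = (\<lambda>y. measure G {x. x + y \<in> A})"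
    using ws by (auto simp: sums_iff)
  finally show ?thesis
    unfolding wI by (simp add: measure_convolution(1)[OF Gd M A])
qed

lemma conv_power_add:
  assumes "real_distribution Q"
  shows "convolution (conv_power Q n) (conv_power Q k) = conv_power Q (n + k)"
proof (induction n)
  case 0
  show ?case
    using convolution_return_zero[OF real_distribution_conv_power[OF assms]] by simp
next
  case (Suc n)
  then show ?case
    using real_distribution_convolution_assoc[OF assms
        real_distribution_conv_power[OF assms] real_distribution_conv_power[OF assms], of n k]
    by simp
qed

text \<open>
  Expanding \<open>G\<close>, the convolution of \<open>Q^n\<close> with \<open>G * F\<close> is the Poisson average over \<open>k\<close> of
  \<open>q (n + k)\<close>, where \<open>q s\<close> is the mass of \<open>A\<close> under \<open>Q^s * F\<close>. Thus the numerical inversion formula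
  applies to each Borel set \<open>A\<close> separately.
\<close>

lemma compound_poisson_deconvolution_sums:
  assumes G: "compound_poisson_with r Q G" and F: "real_distribution F" and A: "A \<in> sets borel"
  shows "(\<lambda>n. exp r * ((- r) ^ n / fact n) * measure (convolution (conv_power Q n) (convolution G F)) A)
    sums measure F A"
proof -
  note r = compound_poisson_withD(1)[OF G] and Gd = compound_poisson_withD(3)[OF G]
    and Qd1 = compound_poisson_withD(2)[OF G]
  note Qd = real_distribution_conv_power[OF Qd1]
  define q where "q s = measure (convolution (conv_power Q s) F) A" for s
  have q1: "\<bar>q s\<bar> \<le> 1" for s
  proof -
    interpret C: real_distribution "convolution (conv_power Q s) F"
      by (rule real_distribution_convolution[OF Qd F])
    show ?thesis by (simp add: q_def)
  qed
  have q0: "q 0 = measure F A"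
    by (simp add: q_def convolution_return_zero[OF F])
  have "exp r * measure (convolution (conv_power Q n) (convolution G F)) A
      = (\<Sum>k. r ^ k / fact k * q (n + k))" for n
  proof -
    have QF: "real_distribution (convolution (conv_power Q n) F)"
      by (rule real_distribution_convolution[OF Qd F])
    have "convolution (conv_power Q n) (convolution G F) = convolution (convolution (conv_power Q n) G) F"
      by (rule real_distribution_convolution_assoc[OF Qd Gd F])
    also have "\<dots> = convolution G (convolution (conv_power Q n) F)"
      using real_distribution_convolution_assoc[OF Gd Qd F]
        real_distribution_convolution_commute[OF Gd Qd] by simp
    finally have 1: "convolution (conv_power Q n) (convolution G F)
        = convolution G (convolution (conv_power Q n) F)" .
    have 2: "convolution (conv_power Q k) (convolution (conv_power Q n) F)
        = convolution (conv_power Q (n + k)) F" for k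
      using real_distribution_convolution_assoc[OF Qd Qd F] conv_power_add[OF Qd1]
      by (simp add: add.commute)
    have "(\<lambda>k. exp r * (exp (- r) * (r ^ k / fact k) * q (n + k)))
        sums (exp r * measure (convolution (conv_power Q n) (convolution G F)) A)"
      using compound_poisson_convolution_sums[OF G QF A] unfolding 1 2 q_def by (rule sums_mult)
    moreover have "exp r * (exp (- r) * (r ^ k / fact k) * q (n + k)) = r ^ k / fact k * q (n + k)" for k
      by (simp add: exp_minus field_simps)
    ultimately show ?thesis
      by (simp only: sums_iff)
  qed
  then have "(\<lambda>n. (- r) ^ n / fact n
      * (exp r * measure (convolution (conv_power Q n) (convolution G F)) A)) sums measure F A"
    using signed_poisson_inverts_poisson[where q = q, OF r q1] by (simp add: q0)
  then show ?thesis
    by (simp add: mult_ac)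
qed

text \<open>Each \<open>Q^n\<close> has positive weight in the mixture \<open>G\<close>, hence charges no set that \<open>G\<close> does not charge.\<close>

lemma on_nonneg_conv_power_if_compound_poisson:
  assumes G: "compound_poisson_with r Q G" and "on_nonneg G"
  shows "on_nonneg (conv_power Q n)"
proof -
  note r = compound_poisson_withD(1)[OF G]
  interpret G: real_distribution G by (rule compound_poisson_withD(3)[OF G])
  interpret C: real_distribution "conv_power Q n"
    by (rule real_distribution_conv_power[OF compound_poisson_withD(2)[OF G]])
  have sp: "UNIV - {0..} = {..<0::real}" by auto
  have "measure G {..<0} = 0"
    using G.prob_compl[of "{0..}"] \<open>on_nonneg G\<close> by (simp add: on_nonneg_def sp)
  then have "exp (- r) * (r ^ n / fact n) * measure (conv_power Q n) {..<0} \<le> 0"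
    using compound_poisson_term_le[OF G, of "{..<0}" n] by simp
  moreover have "exp (- r) * (r ^ n / fact n) > 0"
    using r by simp
  ultimately have "measure (conv_power Q n) {..<0} = 0"
    using mult_pos_pos[of "exp (- r) * (r ^ n / fact n)"] measure_nonneg
    by (meson less_le not_le)
  then show ?thesis
    using C.prob_compl[of "{0..}"] by (simp add: on_nonneg_def sp)
qed

text \<open>
  The Poisson series of \<open>G * (G * F)\<close>, with terms \<open>a x n\<close>, converges together with its terms, since \<open>G\<close> and all
  \<open>Q^n\<close> are locally negligible against \<open>H\<close>. Up to the factor \<open>exp (2 * r)\<close> the inversion formula is the same series with
  alternating signs, to which Scheffe's argument applies.
\<close>

lemma compound_poisson_deconvolution_tendsto:
  assumes c: "c > 0" and G: "compound_poisson_with r Q G" and F: "real_distribution F"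
    and H: "H \<in> S_Delta c"
    and side: "H \<in> D_Delta c \<or> (on_nonneg G \<and> on_nonneg F)"
    and small: "mass_Delta c G \<in> o[at_top](mass_Delta c H)"
    and lim: "((\<lambda>x. mass_Delta c (convolution G F) x / mass_Delta c H x) \<longlongrightarrow> m) at_top"
  shows "((\<lambda>x. mass_Delta c F x / mass_Delta c H x) \<longlongrightarrow> m) at_top"
proof -
  note r = compound_poisson_withD(1)[OF G] and Gd = compound_poisson_withD(3)[OF G]
    and Qd = real_distribution_conv_power[OF compound_poisson_withD(2)[OF G]]
  let ?h = "mass_Delta c H" and ?M = "convolution G F"
  have Md: "real_distribution ?M"
    by (rule real_distribution_convolution[OF Gd F])
  have m0: "m \<ge> 0"
    by (rule tendsto_lowerbound[OF lim]) auto
  define p where "p n = exp (- r) * (r ^ n / fact n)" for n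
  have p0: "p n > 0" for n
    using r by (simp add: p_def)
  have sideM: "H \<in> D_Delta c \<or> (on_nonneg P \<and> on_nonneg ?M)"
    if "on_nonneg G \<Longrightarrow> on_nonneg P" for P
    using side that on_nonneg_convolution[OF Gd F] by auto
  have termlim: "((\<lambda>x. mass_Delta c (convolution (conv_power Q n) ?M) x / ?h x) \<longlongrightarrow> m) at_top" for n
  proof (rule convolution_locally_small_tendsto[OF c Qd Md H sideM _ lim])
    show "on_nonneg G \<Longrightarrow> on_nonneg (conv_power Q n)"
      by (rule on_nonneg_conv_power_if_compound_poisson[OF G])
    have "mass_Delta c (conv_power Q n) \<in> O[at_top](mass_Delta c G)"
    proof (rule bigoI[where c = "1 / p n"], rule always_eventually, rule allI)
      fix x
      show "norm (mass_Delta c (conv_power Q n) x) \<le> 1 / p n * norm (mass_Delta c G x)"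
        using compound_poisson_term_le[OF G, of "{x<..x + c}" n, folded p_def] p0[of n]
        by (simp add: mass_Delta_def field_simps)
    qed
    then show "mass_Delta c (conv_power Q n) \<in> o[at_top](?h)"
      using small by (rule landau_o.big_small_trans)
  qed
  have totlim: "((\<lambda>x. mass_Delta c (convolution G ?M) x / ?h x) \<longlongrightarrow> m) at_top"
    by (rule convolution_locally_small_tendsto[OF c Gd Md H sideM small lim])
  have exps: "(\<lambda>n. x ^ n / fact n) sums exp x" for x :: real
    using exp_converges[of x] by (simp add: divide_inverse mult.commute)
  define a where "a x n = p n * (mass_Delta c (convolution (conv_power Q n) ?M) x / ?h x)" for x n
  have "((\<lambda>x. \<Sum>n. (- 1) ^ n * a x n) \<longlongrightarrow> (\<Sum>n. (- 1) ^ n * (p n * m))) at_top"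
  proof (rule tendsto_alternating_suminf)
    show "\<forall>\<^sub>F x in at_top. \<forall>n. a x n \<ge> 0"
      using p0 by (auto simp: a_def less_imp_le)
    show "\<forall>\<^sub>F x in at_top. a x sums (mass_Delta c (convolution G ?M) x / ?h x)"
    proof (rule always_eventually, rule allI)
      fix x
      have "{x<..x + c} \<in> sets borel" by simp
      from sums_divide[OF compound_poisson_convolution_sums[OF G Md this], of "?h x"]
      show "a x sums (mass_Delta c (convolution G ?M) x / ?h x)"
        by (simp add: a_def [abs_def] p_def mass_Delta_def)
    qed
    show "((\<lambda>x. a x n) \<longlongrightarrow> p n * m) at_top" for n
      unfolding a_def by (intro tendsto_mult_left termlim)
    show "p n * m \<ge> 0" for n
      using p0[of n] m0 by simp
    show "(\<lambda>n. p n * m) sums m"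
      using sums_mult[OF exps[of r], of "exp (- r) * m"]
      by (simp add: p_def mult_ac exp_minus)
  qed (rule totlim)
  from tendsto_mult_left[OF this, of "exp (2 * r)"]
  have L: "((\<lambda>x. exp (2 * r) * (\<Sum>n. (- 1) ^ n * a x n))
      \<longlongrightarrow> exp (2 * r) * (\<Sum>n. (- 1) ^ n * (p n * m))) at_top" .
  have coeff: "exp (2 * r) * ((- 1) ^ n * p n) = exp r * ((- r) ^ n / fact n)" for n
  proof -
    have "exp (2 * r) * ((- 1) ^ n * p n) = (exp (2 * r) * exp (- r)) * ((- 1) ^ n * r ^ n / fact n)"
      by (simp add: p_def)
    also have "exp (2 * r) * exp (- r) = exp r"
      by (simp flip: exp_add)
    also have "(- 1) ^ n * r ^ n = (- r) ^ n"
      by (rule power_minus[symmetric])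
    finally show ?thesis .
  qed
  have "exp (2 * r) * (\<Sum>n. (- 1) ^ n * a x n) = mass_Delta c F x / ?h x" for x
  proof -
    have "{x<..x + c} \<in> sets borel" by simp
    from sums_mult[OF sums_divide[OF compound_poisson_deconvolution_sums[OF G F this], of "?h x"],
        of "exp (- (2 * r))"]
    have s: "(\<lambda>n. exp (- (2 * r)) * (exp r * ((- r) ^ n / fact n)
        * mass_Delta c (convolution (conv_power Q n) ?M) x / ?h x))
      sums (exp (- (2 * r)) * (mass_Delta c F x / ?h x))"
      by (simp add: mass_Delta_def)
    have "exp (- (2 * r)) * (exp r * ((- r) ^ n / fact n)
        * mass_Delta c (convolution (conv_power Q n) ?M) x / ?h x) = (- 1) ^ n * a x n" for n
      unfolding coeff[symmetric] a_def by (simp add: exp_minus)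
    with s have "(\<lambda>n. (- 1) ^ n * a x n) sums (exp (- (2 * r)) * (mass_Delta c F x / ?h x))"
      by simp
    then show ?thesis
      by (simp add: sums_iff exp_minus)
  qed
  moreover have "exp (2 * r) * (\<Sum>n. (- 1) ^ n * (p n * m)) = m"
  proof -
    have "(\<lambda>n. exp (- r) * m * ((- r) ^ n / fact n)) sums (exp (- r) * m * exp (- r))"
      by (rule sums_mult[OF exps])
    moreover have "exp (- r) * m * ((- r) ^ n / fact n) = (- 1) ^ n * (p n * m)" for n
      using power_minus[of r n] by (simp add: p_def)
    ultimately have "(\<Sum>n. (- 1) ^ n * (p n * m)) = exp (- r) * m * exp (- r)"
      by (simp add: sums_iff)
    then have "exp (2 * r) * (\<Sum>n. (- 1) ^ n * (p n * m)) = (exp (2 * r) * exp (- r) * exp (- r)) * m"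
      by (simp only: mult_ac)
    also have "exp (2 * r) * exp (- r) * exp (- r) = 1"
      by (simp only: exp_add[symmetric]) simp
    finally show ?thesis by simp
  qed
  ultimately show ?thesis
    using L by simp
qed

section \<open>The deconvolution theorem\<close>

theorem proposition3p12:
  fixes c :: real and F G H :: "real measure"
  assumes "c > 0"
    and "real_distribution F" and "real_distribution G"
    and "H = convolution G F"
    and "H \<in> S_Delta c"
    and "compound_poisson G"
    and "H \<in> D_Delta c \<or> (on_nonneg F \<and> on_nonneg G \<and> on_nonneg H)"
    and "mass_Delta c G \<in> o[at_top](mass_Delta c H)"
  shows "F \<in> S_Delta c \<and> mass_Delta c H \<sim>[at_top] mass_Delta c F"
proof -
  note c = assms(1) and F = assms(2) and G = assms(3) and HGF = assms(4) and H = assms(5)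
    and side = assms(7) and small = assms(8)
  obtain r Q where GQ: "compound_poisson_with r Q G"
    using assms(6) by (auto simp: compound_poisson_def compound_poisson_with_def)
  let ?h = "mass_Delta c H" and ?f = "mass_Delta c F"
  note Hd = S_DeltaD(1)[OF H] and hpos = S_DeltaD(2)[OF H]
  note FF = real_distribution_convolution[OF F F] and FH = real_distribution_convolution[OF F Hd]
  have "convolution G (convolution F H) = convolution H H"
    using real_distribution_convolution_assoc[OF G F Hd] HGF by simp
  moreover have "convolution G (convolution F F) = convolution F H"
    using real_distribution_convolution_assoc[OF G F F] HGF
      real_distribution_convolution_commute[OF F Hd] by simp
  ultimately have GFH: "convolution G (convolution F H) = convolution H H"
    and GFF: "convolution G (convolution F F) = convolution F H" by auto
  note deconv = compound_poisson_deconvolution_tendsto[OF c GQ _ H _ small]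
  have F1: "((\<lambda>x. ?f x / ?h x) \<longlongrightarrow> 1) at_top"
  proof (rule deconv[OF F])
    show "((\<lambda>x. mass_Delta c (convolution G F) x / ?h x) \<longlongrightarrow> 1) at_top"
      unfolding HGF[symmetric]
      using hpos by (intro tendsto_eventually) (auto elim!: eventually_mono)
  qed (use side in blast)
  have FH2: "((\<lambda>x. mass_Delta c (convolution F H) x / ?h x) \<longlongrightarrow> 2) at_top"
  proof (rule deconv[OF FH])
    show "((\<lambda>x. mass_Delta c (convolution G (convolution F H)) x / ?h x) \<longlongrightarrow> 2) at_top"
      unfolding GFH by (rule S_DeltaD(4)[OF H])
  qed (use side on_nonneg_convolution[OF F Hd] in blast)
  have FF2: "((\<lambda>x. mass_Delta c (convolution F F) x / ?h x) \<longlongrightarrow> 2) at_top"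
  proof (rule deconv[OF FF])
    show "((\<lambda>x. mass_Delta c (convolution G (convolution F F)) x / ?h x) \<longlongrightarrow> 2) at_top"
      unfolding GFF by (rule FH2)
  qed (use side on_nonneg_convolution[OF F F] in blast)
  have fh: "?f \<sim>[at_top] ?h"
    by (rule asymp_equivI'[OF F1])
  have fpos: "\<forall>\<^sub>F x in at_top. ?f x > 0"
  proof -
    have "\<forall>\<^sub>F x in at_top. 0 < ?f x / ?h x"
      by (rule order_tendstoD(1)[OF F1]) simp
    then show ?thesis
      using hpos by eventually_elim (simp add: zero_less_divide_iff)
  qed
  have FF_asymp: "mass_Delta c (convolution F F) \<sim>[at_top] (\<lambda>x. 2 * ?f x)"
  proof (rule asymp_equivI')
    have "((\<lambda>x. (mass_Delta c (convolution F F) x / ?h x) / (2 * (?f x / ?h x))) \<longlongrightarrow> 2 / (2 * 1)) at_top"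
      by (intro tendsto_intros FF2 F1) simp
    then have "((\<lambda>x. (mass_Delta c (convolution F F) x / ?h x) / (2 * (?f x / ?h x))) \<longlongrightarrow> 1) at_top"
      by simp
    then show "((\<lambda>x. mass_Delta c (convolution F F) x / (2 * ?f x)) \<longlongrightarrow> 1) at_top"
      by (rule Lim_transform_eventually) (use hpos in \<open>auto elim!: eventually_mono\<close>)
  qed
  have shift: "(\<lambda>x. ?f (x + y)) \<sim>[at_top] ?f" for y
  proof -
    have "(\<lambda>x. ?f (x + y)) \<sim>[at_top] (\<lambda>x. ?h (x + y))"
      by (rule asymp_equiv_compose'[OF fh filterlim_add_const_at_top])
    also have "(\<lambda>x. ?h (x + y)) \<sim>[at_top] ?h"
      by (rule asymp_equivI'[OF S_DeltaD(3)[OF H]])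
    also have "?h \<sim>[at_top] ?f"
      using fh by (rule asymp_equiv_symI)
    finally show ?thesis .
  qed
  obtain x1 where "\<And>x. x \<ge> x1 \<Longrightarrow> ?f x > 0"
    using fpos by (auto simp: eventually_at_top_linorder)
  then have "\<exists>x0>0. \<forall>x\<ge>x0. ?f x > 0"
    by (intro exI[of _ "max 1 x1"]) auto
  then have "?f \<in> class_L"
    using shift borel_measurable_mass_Delta[OF c F] by (simp add: class_L_def)
  then have "F \<in> S_Delta c"
    using FF_asymp F by (simp add: S_Delta_def L_Delta_def)
  then show ?thesis
    using fh asymp_equiv_symI by blast
qed

end
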